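(* Let $X,Y$ be metric spaces such that either both $X$ and $Y$ are geodesic, with $x_0\in X$, $y_0\in Y$ arbitrary points, or $Y$ is visual from the point $y_0\in Y$, with $x_0\in X$ an arbitrary point. Let $X\ast Y=(X,x_0)\ast_R(Y,y_0)$ for some $R\ge 0$, and let $p_X:X\ast Y\to X$, $p_Y:X\ast Y\to Y$ be the projections. Then the square with maps $p_X:X\ast Y\to X$, $p_Y:X\ast Y\to Y$, $d(\cdot,x_0):X\to\mathbb{R}_{\ge 0}$ and $d(\cdot,y_0):Y\to\mathbb{R}_{\ge0}$ is a limit (pullback) diagram in the coarse category. (In particular, commutativity of diagrams is only required up to closeness.)
   Context: Metrics take only finite values. A subset $E\subseteq X\times X$ of the square of a metric space is an entourage if $\sup_{(x,y)\in E}d(x,y)<\infty$. A map $f:X\to Y$ between metric spaces is coarse if $(f\times f)(E)$ is an entourage for every entourage $E\subseteq X\times X$ and $f^{-1}(B)$ is bounded for every bounded $B\subseteq Y$. Maps $f,g:X\to Y$ are close if $\sup_{x\in X} d(f(x),g(x))<\infty$. The coarse category has metric spaces as objects and coarse maps modulo closeness as morphisms. For every metric space $X$ and $x_0\in X$ the map $d(\cdot,x_0):X\to\mathbb{R}_{\ge0}$ is coarse. The product $X\times Y$ carries the metric $d((x_1,y_1),(x_2,y_2))=\max(d(x_1,x_2),d(y_1,y_2))$. The asymptotic product is $$(X,x_0)\ast_R(Y,y_0)=\{(x,y)\in X\times Y: |d(x_0,x)-d(y_0,y)|\le R\}$$ with the metric restricted from $X\times Y$. A metric space $Y$ is visual from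 $y_0\in Y$ if it is geodesic and every geodesic segment $\gamma:[0,L]\to Y$ ($L\ge 0$, isometric embedding) with $\gamma(0)=y_0$ can be extended to a geodesic ray $[0,\infty)\to Y$ (isometric embedding). $Y$ is called visual if it is visual from some point. *)

theory Defs
  imports "HOL-Analysis.Analysis"
begin

definition entourage :: "'a metric \<Rightarrow> ('a \<times> 'a) set \<Rightarrow> bool" where
  "entourage M E \<longleftrightarrow>
     E \<subseteq> mspace M \<times> mspace M \<and> bdd_above ((\<lambda>(x, y). mdist M x y) ` E)"

definition coarse_map :: "'a metric \<Rightarrow> 'b metric \<Rightarrow> ('a \<Rightarrow> 'b) \<Rightarrow> bool" where
  "coarse_map M N f \<longleftrightarrow>
     f \<in> mspace M \<rightarrow> mspace N \<and>
     (\<forall>E. entourage M E \<longrightarrow> entourage N (map_prod f f ` E)) \<and>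
     (\<forall>B. Metric_space.mbounded (mspace N) (mdist N) B \<longrightarrow>
          Metric_space.mbounded (mspace M) (mdist M) (f -` B \<inter> mspace M))"

definition close_maps :: "'a metric \<Rightarrow> 'b metric \<Rightarrow> ('a \<Rightarrow> 'b) \<Rightarrow> ('a \<Rightarrow> 'b) \<Rightarrow> bool" where
  "close_maps M N f g \<longleftrightarrow> bdd_above ((\<lambda>x. mdist N (f x) (g x)) ` mspace M)"

definition closeness :: "'a metric \<Rightarrow> 'b metric \<Rightarrow> (('a \<Rightarrow> 'b) \<times> ('a \<Rightarrow> 'b)) set" where
  "closeness M N = {(f, g). coarse_map M N f \<and> coarse_map M N g \<and> close_maps M N f g}"

text \<open>
  Values of a HOL function outside \<^term>\<open>mspace M\<close> are irrelevant to
  \<^const>\<open>coarse_map\<close> and \<^const>\<open>close_maps\<close>, so the quotient below also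
  identifies functions that differ only there.
\<close>

definition coarse_hom :: "'a metric \<Rightarrow> 'b metric \<Rightarrow> ('a \<Rightarrow> 'b) set set" where
  "coarse_hom M N = {f. coarse_map M N f} // closeness M N"

definition coarse_class :: "'a metric \<Rightarrow> 'b metric \<Rightarrow> ('a \<Rightarrow> 'b) \<Rightarrow> ('a \<Rightarrow> 'b) set" where
  "coarse_class M N f = closeness M N `` {f}"

definition coarse_comp ::
  "'a metric \<Rightarrow> 'c metric \<Rightarrow> ('b \<Rightarrow> 'c) set \<Rightarrow> ('a \<Rightarrow> 'b) set \<Rightarrow> ('a \<Rightarrow> 'c) set" where
  "coarse_comp M K G F = (\<Union>g\<in>G. \<Union>f\<in>F. coarse_class M K (g \<circ> f))"

lemma entourage_iff:
  "entourage M E \<longleftrightarrow>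
     E \<subseteq> mspace M \<times> mspace M \<and> (\<exists>C. \<forall>(x, y)\<in>E. mdist M x y \<le> C)"
  unfolding entourage_def bdd_above_def by fastforce

lemma close_maps_iff:
  "close_maps M N f g \<longleftrightarrow> (\<exists>C. \<forall>x\<in>mspace M. mdist N (f x) (g x) \<le> C)"
  unfolding close_maps_def bdd_above_def by auto

lemma coarse_map_in: "coarse_map M N f \<Longrightarrow> x \<in> mspace M \<Longrightarrow> f x \<in> mspace N"
  by (auto simp: coarse_map_def)

lemma close_maps_trans:
  assumes "coarse_map M N f" "coarse_map M N g" "coarse_map M N h"
    and "close_maps M N f g" "close_maps M N g h"
  shows "close_maps M N f h"
proof -
  obtain C D where "\<forall>x\<in>mspace M. mdist N (f x) (g x) \<le> C" "\<forall>x\<in>mspace M. mdist N (g x) (h x) \<le> D"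
    using assms(4,5) by (auto simp: close_maps_iff)
  moreover have "mdist N (f x) (h x) \<le> mdist N (f x) (g x) + mdist N (g x) (h x)"
    if "x \<in> mspace M" for x
    using that assms(1-3) by (intro mdist_triangle coarse_map_in[of M N])
  ultimately have "\<forall>x\<in>mspace M. mdist N (f x) (h x) \<le> C + D"
    by (meson add_mono order_trans)
  then show ?thesis
    by (auto simp: close_maps_iff)
qed

lemma equiv_closeness: "equiv {f. coarse_map M N f} (closeness M N)"
proof (rule equivI)
  have "mdist N (f x) (f x) = 0" if "coarse_map M N f" "x \<in> mspace M" for f x
    using coarse_map_in[OF that] by simp
  then show "refl_on {f. coarse_map M N f} (closeness M N)"
    by (auto simp: refl_on_def closeness_def close_maps_iff intro!: exI[of _ 0])
  show "sym (closeness M N)"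
    by (auto simp: sym_def closeness_def close_maps_def mdist_commute)
  show "trans (closeness M N)"
    by (auto simp: trans_def closeness_def intro: close_maps_trans)
qed (auto simp: closeness_def)

lemma coarse_map_id: "coarse_map M M id"
  by (auto simp: coarse_map_def map_prod.id Metric_space.mbounded_subset_mspace
      intro: Metric_space.mbounded_subset[OF Metric_space_mspace_mdist])

lemma coarse_map_comp:
  assumes f: "coarse_map M N f" and g: "coarse_map N K g"
  shows "coarse_map M K (g \<circ> f)"
  unfolding coarse_map_def
proof (intro conjI allI impI)
  show "g \<circ> f \<in> mspace M \<rightarrow> mspace K"
    using f g by (auto simp: coarse_map_def)
next
  fix E assume "entourage M E"
  then have "entourage K (map_prod g g ` (map_prod f f ` E))"
    using f g by (auto simp: coarse_map_def)
  then show "entourage K (map_prod (g \<circ> f) (g \<circ> f) ` E)"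
    by (simp add: image_comp map_prod.comp)
next
  fix B assume "Metric_space.mbounded (mspace K) (mdist K) B"
  then have "Metric_space.mbounded (mspace M) (mdist M)
      (f -` (g -` B \<inter> mspace N) \<inter> mspace M)"
    using f g by (auto simp: coarse_map_def)
  moreover have "f -` (g -` B \<inter> mspace N) \<inter> mspace M = (g \<circ> f) -` B \<inter> mspace M"
    using f by (auto simp: coarse_map_def)
  ultimately show "Metric_space.mbounded (mspace M) (mdist M) ((g \<circ> f) -` B \<inter> mspace M)"
    by simp
qed

lemma closeness_comp:
  assumes f: "(f, f') \<in> closeness M N" and g: "(g, g') \<in> closeness N K"
  shows "(g \<circ> f, g' \<circ> f') \<in> closeness M K"
proof -
  have co: "coarse_map M N f" "coarse_map M N f'" "coarse_map N K g" "coarse_map N K g'"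
    using f g by (auto simp: closeness_def)
  have "entourage N ((\<lambda>x. (f x, f' x)) ` mspace M)"
    using f co by (auto simp: closeness_def close_maps_iff entourage_iff intro: coarse_map_in)
  then have "entourage K (map_prod g g ` ((\<lambda>x. (f x, f' x)) ` mspace M))"
    using co by (auto simp: coarse_map_def)
  then have 1: "close_maps M K (g \<circ> f) (g \<circ> f')"
    by (auto simp: entourage_iff close_maps_iff)
  have 2: "close_maps M K (g \<circ> f') (g' \<circ> f')"
    using g co by (auto simp: closeness_def close_maps_iff intro: coarse_map_in)
  show ?thesis
    using close_maps_trans[OF coarse_map_comp coarse_map_comp coarse_map_comp 1 2] co
    by (simp add: closeness_def coarse_map_comp[of M N _ K])
qed

lemma coarse_class_in_hom: "coarse_map M N f \<Longrightarrow> coarse_class M N f \<in> coarse_hom M N"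
  by (auto simp: coarse_class_def coarse_hom_def intro: quotientI)

lemma coarse_hom_cases:
  assumes "F \<in> coarse_hom M N"
  obtains f where "coarse_map M N f" "F = coarse_class M N f"
  using assms by (auto simp: coarse_class_def coarse_hom_def elim: quotientE)

lemma coarse_class_eq_iff:
  assumes "coarse_map M N f" "coarse_map M N g"
  shows "coarse_class M N f = coarse_class M N g \<longleftrightarrow> close_maps M N f g"
  using eq_equiv_class_iff[OF equiv_closeness, of f M N g] assms
  by (auto simp: coarse_class_def closeness_def)

lemma coarse_comp_class:
  assumes f: "coarse_map M N f" and g: "coarse_map N K g"
  shows "coarse_comp M K (coarse_class N K g) (coarse_class M N f) = coarse_class M K (g \<circ> f)"
proof -
  have "coarse_class M K (g' \<circ> f') = coarse_class M K (g \<circ> f)"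
    if "g' \<in> coarse_class N K g" "f' \<in> coarse_class M N f" for f' g'
    using that closeness_comp[of f f' M N g g' K] equiv_class_eq[OF equiv_closeness, of _ _ M K]
    by (auto simp: coarse_class_def)
  moreover have "g \<in> coarse_class N K g" "f \<in> coarse_class M N f"
    using f g equiv_class_self[OF equiv_closeness] by (auto simp: coarse_class_def)
  ultimately show ?thesis
    unfolding coarse_comp_def by blast
qed

text \<open>
  HOL cannot quantify over all types inside a formula, so the type of the points of
  the test objects \<open>Z\<close> is a parameter; a statement about arbitrary \<open>'z\<close> covers all
  metric spaces.
\<close>

definition coarse_pullback ::
  "'z itself \<Rightarrow> 'p metric \<Rightarrow> 'a metric \<Rightarrow> 'b metric \<Rightarrow> 'w metric \<Rightarrow>
   ('p \<Rightarrow> 'a) set \<Rightarrow> ('p \<Rightarrow> 'b) set \<Rightarrow> ('a \<Rightarrow> 'w) set \<Rightarrow> ('b \<Rightarrow> 'w) set \<Rightarrow> bool" where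
  "coarse_pullback TYPE('z) P X Y W p q f g \<longleftrightarrow>
     p \<in> coarse_hom P X \<and> q \<in> coarse_hom P Y \<and>
     f \<in> coarse_hom X W \<and> g \<in> coarse_hom Y W \<and>
     coarse_comp P W f p = coarse_comp P W g q \<and>
     (\<forall>Z :: 'z metric. \<forall>u \<in> coarse_hom Z X. \<forall>v \<in> coarse_hom Z Y.
        coarse_comp Z W f u = coarse_comp Z W g v \<longrightarrow>
        (\<exists>!h. h \<in> coarse_hom Z P \<and> coarse_comp Z X p h = u \<and> coarse_comp Z Y q h = v))"

text \<open>The library's \<^const>\<open>prod_metric\<close> is the Euclidean product metric, not the maximum metric.\<close>

definition max_prod_metric :: "'a metric \<Rightarrow> 'b metric \<Rightarrow> ('a \<times> 'b) metric" where
  "max_prod_metric M N =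
     metric (mspace M \<times> mspace N,
             \<lambda>(x1, y1) (x2, y2). max (mdist M x1 x2) (mdist N y1 y2))"

lemma Metric_space_max_prod:
  "Metric_space (mspace M \<times> mspace N)
     (\<lambda>(x1, y1) (x2, y2). max (mdist M x1 x2) (mdist N y1 y2))"
proof
  fix p q r :: "'a \<times> 'b"
  show "0 \<le> (case p of (x1, y1) \<Rightarrow> \<lambda>(x2, y2). max (mdist M x1 x2) (mdist N y1 y2)) q"
    by (auto simp: max_def split: prod.splits)
  show "(case p of (x1, y1) \<Rightarrow> \<lambda>(x2, y2). max (mdist M x1 x2) (mdist N y1 y2)) q =
        (case q of (x1, y1) \<Rightarrow> \<lambda>(x2, y2). max (mdist M x1 x2) (mdist N y1 y2)) p"
    by (auto simp: mdist_commute split: prod.splits)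
  assume p: "p \<in> mspace M \<times> mspace N" and q: "q \<in> mspace M \<times> mspace N"
  have "max a b = 0 \<longleftrightarrow> a = 0 \<and> b = 0" if "0 \<le> a" "0 \<le> b" for a b :: real
    using that by linarith
  then show "((case p of (x1, y1) \<Rightarrow> \<lambda>(x2, y2). max (mdist M x1 x2) (mdist N y1 y2)) q = 0) =
        (p = q)"
    using p q by (auto simp: split: prod.splits)
  assume r: "r \<in> mspace M \<times> mspace N"
  obtain a b c d e f where "p = (a, b)" "q = (c, d)" "r = (e, f)"
    by (metis surj_pair)
  then show "(case p of (x1, y1) \<Rightarrow> \<lambda>(x2, y2). max (mdist M x1 x2) (mdist N y1 y2)) r
        \<le> (case p of (x1, y1) \<Rightarrow> \<lambda>(x2, y2). max (mdist M x1 x2) (mdist N y1 y2)) q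
        + (case q of (x1, y1) \<Rightarrow> \<lambda>(x2, y2). max (mdist M x1 x2) (mdist N y1 y2)) r"
    using p q r mdist_triangle[of a M c e] mdist_triangle[of b N d f] by auto
qed

lemma mspace_max_prod_metric [simp]: "mspace (max_prod_metric M N) = mspace M \<times> mspace N"
  by (simp add: max_prod_metric_def Metric_space.mspace_metric[OF Metric_space_max_prod])

lemma mdist_max_prod_metric [simp]:
  "mdist (max_prod_metric M N) (x1, y1) (x2, y2) = max (mdist M x1 x2) (mdist N y1 y2)"
  by (simp add: max_prod_metric_def Metric_space.mdist_metric[OF Metric_space_max_prod])

definition asymptotic_product ::
  "'a metric \<Rightarrow> 'a \<Rightarrow> 'b metric \<Rightarrow> 'b \<Rightarrow> real \<Rightarrow> ('a \<times> 'b) metric" where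
  "asymptotic_product X x0 Y y0 R =
     submetric (max_prod_metric X Y)
       {(x, y). x \<in> mspace X \<and> y \<in> mspace Y \<and> \<bar>mdist X x0 x - mdist Y y0 y\<bar> \<le> R}"

abbreviation interval_metric :: "real set \<Rightarrow> real metric" where
  "interval_metric I \<equiv> submetric euclidean_metric I"

definition isometric_embedding :: "'a metric \<Rightarrow> 'b metric \<Rightarrow> ('a \<Rightarrow> 'b) \<Rightarrow> bool" where
  "isometric_embedding M N f \<longleftrightarrow>
     f \<in> mspace M \<rightarrow> mspace N \<and>
     (\<forall>x\<in>mspace M. \<forall>y\<in>mspace M. mdist N (f x) (f y) = mdist M x y)"

definition geodesic_segment :: "'a metric \<Rightarrow> real \<Rightarrow> (real \<Rightarrow> 'a) \<Rightarrow> bool" where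
  "geodesic_segment M L \<gamma> \<longleftrightarrow> 0 \<le> L \<and> isometric_embedding (interval_metric {0..L}) M \<gamma>"

definition geodesic_ray :: "'a metric \<Rightarrow> (real \<Rightarrow> 'a) \<Rightarrow> bool" where
  "geodesic_ray M \<rho> \<longleftrightarrow> isometric_embedding (interval_metric {0..}) M \<rho>"

definition geodesic_space :: "'a metric \<Rightarrow> bool" where
  "geodesic_space M \<longleftrightarrow>
     (\<forall>x\<in>mspace M. \<forall>y\<in>mspace M. \<exists>L \<gamma>. geodesic_segment M L \<gamma> \<and> \<gamma> 0 = x \<and> \<gamma> L = y)"

definition visual_from :: "'a metric \<Rightarrow> 'a \<Rightarrow> bool" where
  "visual_from M y0 \<longleftrightarrow>
     y0 \<in> mspace M \<and> geodesic_space M \<and>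
     (\<forall>L \<gamma>. geodesic_segment M L \<gamma> \<and> \<gamma> 0 = y0 \<longrightarrow>
        (\<exists>\<rho>. geodesic_ray M \<rho> \<and> (\<forall>t\<in>{0..L}. \<rho> t = \<gamma> t)))"

end

theory Submission
  imports Defs
begin

text \<open>
  A cone over the cospan is a pair of coarse maps \<open>u : Z \<rightarrow> X\<close>, \<open>v : Z \<rightarrow> Y\<close> whose radii
  \<open>d(u z, x0)\<close> and \<open>d(v z, y0)\<close> differ by a bounded amount \<open>C\<close>. The asymptotic product only
  admits pairs whose radii differ by at most \<open>R\<close>, and \<open>C\<close> may be much larger, so
  \<open>z \<mapsto> (u z, v z)\<close> need not land in it. The geometric hypothesis repairs this
  (\<open>equal_radius_points\<close>): a pair \<open>(x, y)\<close> can be moved to a pair of equal radii by displacing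
  each coordinate no further than the difference of the radii. If both spaces are geodesic, the
  point of larger radius slides towards its base point; if \<open>Y\<close> is visual, \<open>y\<close> slides inwards
  or outwards along a ray from \<open>y0\<close> through \<open>y\<close> until its radius is that of \<open>x\<close>. Applied to
  every \<open>(u z, v z)\<close>, this changes \<open>u\<close> and \<open>v\<close> only within their closeness classes, which are
  all the coarse category sees; pairs of equal radii lie in the asymptotic product for every
  \<open>R \<ge> 0\<close>. The new points can be chosen independently for each \<open>z\<close>, because any map close to
  a coarse map is coarse (\<open>coarse_map_close\<close>).

  Uniqueness holds because the metric on the product is the maximum of the two coordinate
  metrics: maps with close coordinates are close. The bound \<open>R\<close> on the difference of the radii
  makes the square commute up to closeness, and it also makes the projections metrically proper,
  since a bound on one coordinate bounds its radius, hence the radius of the other coordinate.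
\<close>

section \<open>Coarse maps\<close>

text \<open>
  Quantifying over all base points \<open>m\<close>, rather than fixing one, makes the criterion
  valid for the empty space as well.
\<close>

lemma coarse_map_iff:
  "coarse_map M N f \<longleftrightarrow>
     f \<in> mspace M \<rightarrow> mspace N \<and>
     (\<forall>r. \<exists>s. \<forall>x\<in>mspace M. \<forall>y\<in>mspace M. mdist M x y \<le> r \<longrightarrow> mdist N (f x) (f y) \<le> s) \<and>
     (\<forall>m\<in>mspace M. \<forall>r. \<exists>s. \<forall>x\<in>mspace M. mdist N (f m) (f x) \<le> r \<longrightarrow> mdist M m x \<le> s)"
    (is "_ \<longleftrightarrow> ?into \<and> ?control \<and> ?proper")
proof (intro iffI conjI)
  interpret M: Metric_space "mspace M" "mdist M" by simp
  interpret N: Metric_space "mspace N" "mdist N" by simp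
  assume f: "coarse_map M N f"
  show into: ?into using f by (simp add: coarse_map_def)
  show ?control
  proof
    fix r
    let ?E = "{(x, y). x \<in> mspace M \<and> y \<in> mspace M \<and> mdist M x y \<le> r}"
    have "entourage M ?E" by (auto simp: entourage_iff)
    then have "entourage N (map_prod f f ` ?E)" using f by (simp add: coarse_map_def)
    then obtain s where "\<forall>(x, y)\<in>map_prod f f ` ?E. mdist N x y \<le> s"
      by (auto simp: entourage_iff)
    then show "\<exists>s. \<forall>x\<in>mspace M. \<forall>y\<in>mspace M. mdist M x y \<le> r \<longrightarrow> mdist N (f x) (f y) \<le> s"
      by (intro exI[of _ s]) force
  qed
  show ?proper
  proof (intro ballI allI)
    fix m r assume m: "m \<in> mspace M"
    let ?B = "f -` N.mcball (f m) r \<inter> mspace M"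
    have "M.mbounded ?B" using f N.mbounded_mcball by (simp add: coarse_map_def)
    then obtain s where s: "\<forall>x\<in>?B. \<forall>y\<in>?B. mdist M x y \<le> s"
      unfolding M.mbounded_alt by blast
    have "mdist M m x \<le> s" if x: "x \<in> mspace M" "mdist N (f m) (f x) \<le> r" for x
    proof (rule s[rule_format])
      have "0 \<le> r" by (rule order_trans[OF mdist_nonneg x(2)])
      then show "m \<in> ?B" using m funcset_mem[OF into m] by simp
      show "x \<in> ?B" using x m into by auto
    qed
    then show "\<exists>s. \<forall>x\<in>mspace M. mdist N (f m) (f x) \<le> r \<longrightarrow> mdist M m x \<le> s"
      by blast
  qed
next
  interpret M: Metric_space "mspace M" "mdist M" by simp
  interpret N: Metric_space "mspace N" "mdist N" by simp
  assume *: "?into \<and> ?control \<and> ?proper"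
  show "coarse_map M N f"
    unfolding coarse_map_def
  proof (intro conjI allI impI)
    show ?into using * by blast
  next
    fix E assume E: "entourage M E"
    then obtain r where E: "E \<subseteq> mspace M \<times> mspace M" "\<forall>(x, y)\<in>E. mdist M x y \<le> r"
      by (auto simp: entourage_iff)
    obtain s where
      "\<forall>x\<in>mspace M. \<forall>y\<in>mspace M. mdist M x y \<le> r \<longrightarrow> mdist N (f x) (f y) \<le> s"
      using * by blast
    then have "\<forall>(x, y)\<in>E. mdist N (f x) (f y) \<le> s"
      using E by blast
    moreover have "map_prod f f ` E \<subseteq> mspace N \<times> mspace N"
      using E(1) * by (auto simp: Pi_iff)
    ultimately show "entourage N (map_prod f f ` E)"
      unfolding entourage_iff by (intro conjI exI[of _ s]) auto
  next
    fix B assume B: "N.mbounded B"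
    show "M.mbounded (f -` B \<inter> mspace M)"
    proof (cases "f -` B \<inter> mspace M = {}")
      case True
      then show ?thesis by (simp add: M.mbounded_empty)
    next
      case False
      then obtain m where m: "m \<in> mspace M" "f m \<in> B" by blast
      obtain r where r: "\<forall>x\<in>B. \<forall>y\<in>B. mdist N x y \<le> r"
        using B by (auto simp: N.mbounded_alt)
      obtain s where "\<forall>x\<in>mspace M. mdist N (f m) (f x) \<le> r \<longrightarrow> mdist M m x \<le> s"
        using * m by blast
      then have "f -` B \<inter> mspace M \<subseteq> M.mcball m s" using r m by auto
      then show ?thesis using M.mbounded_def by blast
    qed
  qed
qed

lemma coarse_map_close:
  assumes f: "coarse_map M N f" and g: "g \<in> mspace M \<rightarrow> mspace N" and fg: "close_maps M N f g"
  shows "coarse_map M N g"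
proof -
  obtain C where C: "\<And>x. x \<in> mspace M \<Longrightarrow> mdist N (f x) (g x) \<le> C"
    using fg by (auto simp: close_maps_iff)
  have bounds: "mdist N (g x) (g y) \<le> mdist N (f x) (f y) + 2 * C"
      "mdist N (f x) (f y) \<le> mdist N (g x) (g y) + 2 * C"
    if "x \<in> mspace M" "y \<in> mspace M" for x y
  proof -
    have "f x \<in> mspace N" "f y \<in> mspace N" "g x \<in> mspace N" "g y \<in> mspace N"
      using that g coarse_map_in[OF f] by auto
    then show "mdist N (g x) (g y) \<le> mdist N (f x) (f y) + 2 * C"
        "mdist N (f x) (f y) \<le> mdist N (g x) (g y) + 2 * C"
      using C[OF that(1)] C[OF that(2)]
        mdist_triangle[of "g x" N "f x" "g y"] mdist_triangle[of "f x" N "f y" "g y"]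
        mdist_triangle[of "f x" N "g x" "f y"] mdist_triangle[of "g x" N "g y" "f y"]
      by (simp_all add: mdist_commute)
  qed
  show ?thesis
    unfolding coarse_map_iff
  proof (intro conjI ballI allI)
    fix r
    obtain s where
      "\<forall>x\<in>mspace M. \<forall>y\<in>mspace M. mdist M x y \<le> r \<longrightarrow> mdist N (f x) (f y) \<le> s"
      using f by (meson coarse_map_iff)
    then show
      "\<exists>s. \<forall>x\<in>mspace M. \<forall>y\<in>mspace M. mdist M x y \<le> r \<longrightarrow> mdist N (g x) (g y) \<le> s"
      using bounds(1) by (intro exI[of _ "s + 2 * C"]) fastforce
  next
    fix m r assume m: "m \<in> mspace M"
    obtain s where
      "\<forall>x\<in>mspace M. mdist N (f m) (f x) \<le> r + 2 * C \<longrightarrow> mdist M m x \<le> s"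
      using f m by (meson coarse_map_iff)
    then show "\<exists>s. \<forall>x\<in>mspace M. mdist N (g m) (g x) \<le> r \<longrightarrow> mdist M m x \<le> s"
      using bounds(2) m by (intro exI[of _ s]) fastforce
  qed (use g in auto)
qed

lemma coarse_map_radius:
  assumes "m0 \<in> mspace M"
  shows "coarse_map M (interval_metric {0..}) (\<lambda>x. mdist M x m0)"
proof -
  have "\<bar>mdist M x m0 - mdist M y m0\<bar> \<le> mdist M x y"
      "mdist M x y \<le> \<bar>mdist M x m0 - mdist M y m0\<bar> + 2 * mdist M x m0"
    if "x \<in> mspace M" "y \<in> mspace M" for x y
    using assms that mdist_triangle[of x M y m0] mdist_triangle[of y M x m0]
      mdist_triangle[of x M m0 y] by (simp_all add: mdist_commute)
  then show ?thesis
    unfolding coarse_map_iff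
    by (auto simp: dist_real_def intro: order_trans)
      (meson add_mono order_refl order_trans)
qed

section \<open>The asymptotic product\<close>

lemma mspace_asymptotic_product:
  "mspace (asymptotic_product X x0 Y y0 R) =
     {(x, y). x \<in> mspace X \<and> y \<in> mspace Y \<and> \<bar>mdist X x0 x - mdist Y y0 y\<bar> \<le> R}"
  by (auto simp: asymptotic_product_def)

lemma mdist_asymptotic_product:
  "mdist (asymptotic_product X x0 Y y0 R) p q =
     max (mdist X (fst p) (fst q)) (mdist Y (snd p) (snd q))"
  by (cases p; cases q) (simp add: asymptotic_product_def)

lemma coarse_map_asymptotic_fst:
  assumes "x0 \<in> mspace X" and "y0 \<in> mspace Y"
  shows "coarse_map (asymptotic_product X x0 Y y0 R) X fst"
  unfolding coarse_map_iff
proof (intro conjI ballI allI)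
  fix m r assume m: "m \<in> mspace (asymptotic_product X x0 Y y0 R)"
  obtain a b where ab: "m = (a, b)" "a \<in> mspace X" "b \<in> mspace Y"
    using m by (auto simp: mspace_asymptotic_product)
  have "mdist Y b y \<le> r + mdist X x0 a + R + mdist Y y0 b"
    if "x \<in> mspace X" "y \<in> mspace Y" "\<bar>mdist X x0 x - mdist Y y0 y\<bar> \<le> R" "mdist X a x \<le> r"
    for x y
    using that assms ab mdist_triangle[of b Y y0 y] mdist_triangle[of x0 X a x]
    by (simp add: mdist_commute)
  then show "\<exists>s. \<forall>x\<in>mspace (asymptotic_product X x0 Y y0 R). mdist X (fst m) (fst x) \<le> r \<longrightarrow>
      mdist (asymptotic_product X x0 Y y0 R) m x \<le> s"
    using ab by (intro exI[of _ "max r (r + mdist X x0 a + R + mdist Y y0 b)"])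
      (fastforce simp: mspace_asymptotic_product mdist_asymptotic_product max.coboundedI1 max.coboundedI2)
qed (auto simp: mspace_asymptotic_product mdist_asymptotic_product)

lemma coarse_map_asymptotic_snd:
  assumes "x0 \<in> mspace X" and "y0 \<in> mspace Y"
  shows "coarse_map (asymptotic_product X x0 Y y0 R) Y snd"
  unfolding coarse_map_iff
proof (intro conjI ballI allI)
  fix m r assume m: "m \<in> mspace (asymptotic_product X x0 Y y0 R)"
  obtain a b where ab: "m = (a, b)" "a \<in> mspace X" "b \<in> mspace Y"
    using m by (auto simp: mspace_asymptotic_product)
  have "mdist X a x \<le> r + mdist Y y0 b + R + mdist X x0 a"
    if "x \<in> mspace X" "y \<in> mspace Y" "\<bar>mdist X x0 x - mdist Y y0 y\<bar> \<le> R" "mdist Y b y \<le> r"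
    for x y
    using that assms ab mdist_triangle[of a X x0 x] mdist_triangle[of y0 Y b y]
    by (simp add: mdist_commute)
  then show "\<exists>s. \<forall>x\<in>mspace (asymptotic_product X x0 Y y0 R). mdist Y (snd m) (snd x) \<le> r \<longrightarrow>
      mdist (asymptotic_product X x0 Y y0 R) m x \<le> s"
    using ab by (intro exI[of _ "max r (r + mdist Y y0 b + R + mdist X x0 a)"])
      (fastforce simp: mspace_asymptotic_product mdist_asymptotic_product max.coboundedI1 max.coboundedI2)
qed (auto simp: mspace_asymptotic_product mdist_asymptotic_product)

lemma coarse_map_into_asymptotic_product:
  assumes h: "h \<in> mspace Z \<rightarrow> mspace (asymptotic_product X x0 Y y0 R)"
    and u: "coarse_map Z X (fst \<circ> h)" and v: "coarse_map Z Y (snd \<circ> h)"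
  shows "coarse_map Z (asymptotic_product X x0 Y y0 R) h"
  unfolding coarse_map_iff
proof (intro conjI ballI allI)
  fix r
  obtain s t where
    "\<forall>x\<in>mspace Z. \<forall>y\<in>mspace Z. mdist Z x y \<le> r \<longrightarrow> mdist X (fst (h x)) (fst (h y)) \<le> s"
    "\<forall>x\<in>mspace Z. \<forall>y\<in>mspace Z. mdist Z x y \<le> r \<longrightarrow> mdist Y (snd (h x)) (snd (h y)) \<le> t"
    using u v unfolding coarse_map_iff comp_def by meson
  then show "\<exists>s. \<forall>x\<in>mspace Z. \<forall>y\<in>mspace Z. mdist Z x y \<le> r \<longrightarrow>
      mdist (asymptotic_product X x0 Y y0 R) (h x) (h y) \<le> s"
    by (intro exI[of _ "max s t"])
      (auto simp: mdist_asymptotic_product max.coboundedI1 max.coboundedI2)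
next
  fix m r assume "m \<in> mspace Z"
  then obtain s where
    "\<forall>x\<in>mspace Z. mdist X (fst (h m)) (fst (h x)) \<le> r \<longrightarrow> mdist Z m x \<le> s"
    using u unfolding coarse_map_iff comp_def by meson
  then show "\<exists>s. \<forall>x\<in>mspace Z. mdist (asymptotic_product X x0 Y y0 R) (h m) (h x) \<le> r \<longrightarrow>
      mdist Z m x \<le> s"
    by (auto simp: mdist_asymptotic_product)
qed (use h in auto)

lemma close_maps_into_asymptotic_product:
  assumes "close_maps Z X (fst \<circ> h) (fst \<circ> k)" and "close_maps Z Y (snd \<circ> h) (snd \<circ> k)"
  shows "close_maps Z (asymptotic_product X x0 Y y0 R) h k"
proof -
  obtain C D where "\<forall>z\<in>mspace Z. mdist X (fst (h z)) (fst (k z)) \<le> C"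
    "\<forall>z\<in>mspace Z. mdist Y (snd (h z)) (snd (k z)) \<le> D"
    using assms by (auto simp: close_maps_iff)
  then show ?thesis
    unfolding close_maps_iff
    by (intro exI[of _ "max C D"])
      (auto simp: mdist_asymptotic_product max.coboundedI1 max.coboundedI2)
qed

section \<open>Moving a pair of points to equal radii\<close>

lemma geodesic_segment_mdist:
  assumes "geodesic_segment M L \<gamma>" and "s \<in> {0..L}" and "t \<in> {0..L}"
  shows "\<gamma> s \<in> mspace M" and "mdist M (\<gamma> s) (\<gamma> t) = \<bar>s - t\<bar>"
  using assms by (auto simp: geodesic_segment_def isometric_embedding_def dist_real_def)

lemma geodesic_ray_mdist:
  assumes "geodesic_ray M \<rho>" and "0 \<le> s" and "0 \<le> t"
  shows "\<rho> s \<in> mspace M" and "mdist M (\<rho> s) (\<rho> t) = \<bar>s - t\<bar>"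
  using assms by (auto simp: geodesic_ray_def isometric_embedding_def dist_real_def)

lemma geodesic_space_point_at_radius:
  assumes M: "geodesic_space M" "m0 \<in> mspace M" "x \<in> mspace M"
    and r: "0 \<le> r" "r \<le> mdist M m0 x"
  obtains x' where "x' \<in> mspace M" "mdist M m0 x' = r" "mdist M x x' = mdist M m0 x - r"
proof -
  obtain L \<gamma> where \<gamma>: "geodesic_segment M L \<gamma>" "\<gamma> 0 = m0" "\<gamma> L = x"
    using M unfolding geodesic_space_def by meson
  have L: "L = mdist M m0 x"
    using geodesic_segment_mdist(2)[OF \<gamma>(1), of 0 L] \<gamma> by (auto simp: geodesic_segment_def)
  show thesis
    using that[of "\<gamma> r"] r L geodesic_segment_mdist[OF \<gamma>(1), of r L]
      geodesic_segment_mdist(2)[OF \<gamma>(1), of 0 r] geodesic_segment_mdist(2)[OF \<gamma>(1), of L r] \<gamma>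
    by auto
qed

lemma visual_from_point_at_radius:
  assumes M: "visual_from M m0" "x \<in> mspace M" and r: "0 \<le> r"
  obtains x' where "x' \<in> mspace M" "mdist M m0 x' = r" "mdist M x x' = \<bar>mdist M m0 x - r\<bar>"
proof -
  obtain L \<gamma> where \<gamma>: "geodesic_segment M L \<gamma>" "\<gamma> 0 = m0" "\<gamma> L = x"
    using M unfolding visual_from_def geodesic_space_def by meson
  then obtain \<rho> where \<rho>: "geodesic_ray M \<rho>" "\<forall>t\<in>{0..L}. \<rho> t = \<gamma> t"
    using M(1) unfolding visual_from_def by metis
  have L: "0 \<le> L" using \<gamma> by (simp add: geodesic_segment_def)
  then have \<rho>0: "\<rho> 0 = m0" "\<rho> L = x" using \<rho>(2) \<gamma> by auto
  have "L = mdist M m0 x" using geodesic_ray_mdist(2)[OF \<rho>(1), of 0 L] \<rho>0 L by auto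
  then show thesis
    using that[of "\<rho> r"] r L \<rho>0 geodesic_ray_mdist(1)[OF \<rho>(1) r r]
      geodesic_ray_mdist(2)[OF \<rho>(1), of 0 r] geodesic_ray_mdist(2)[OF \<rho>(1), of L r]
    by auto
qed

text \<open>
  The common radius is the smaller of the two radii when both spaces are geodesic, since segments
  can only be followed inwards, and the radius of \<open>x\<close> when \<open>Y\<close> is visual, since then nothing is
  known about \<open>X\<close> beyond its metric and \<open>x\<close> has to stay where it is.
\<close>

lemma equal_radius_points:
  assumes "x0 \<in> mspace X" and "y0 \<in> mspace Y"
    and geom: "geodesic_space X \<and> geodesic_space Y \<or> visual_from Y y0"
    and "x \<in> mspace X" and "y \<in> mspace Y"
  obtains x' y' where "x' \<in> mspace X" "y' \<in> mspace Y" "mdist X x0 x' = mdist Y y0 y'"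
    "mdist X x x' \<le> \<bar>mdist X x0 x - mdist Y y0 y\<bar>"
    "mdist Y y y' \<le> \<bar>mdist X x0 x - mdist Y y0 y\<bar>"
  using geom
proof
  assume g: "geodesic_space X \<and> geodesic_space Y"
  let ?r = "min (mdist X x0 x) (mdist Y y0 y)"
  obtain x' where "x' \<in> mspace X" "mdist X x0 x' = ?r" "mdist X x x' = mdist X x0 x - ?r"
    using geodesic_space_point_at_radius[of X x0 x ?r] g assms by auto
  moreover obtain y' where "y' \<in> mspace Y" "mdist Y y0 y' = ?r" "mdist Y y y' = mdist Y y0 y - ?r"
    using geodesic_space_point_at_radius[of Y y0 y ?r] g assms by auto
  ultimately show thesis using that[of x' y'] by linarith
next
  assume "visual_from Y y0"
  then obtain y' where "y' \<in> mspace Y" "mdist Y y0 y' = mdist X x0 x"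
      "mdist Y y y' = \<bar>mdist Y y0 y - mdist X x0 x\<bar>"
    using visual_from_point_at_radius[of Y y0 y "mdist X x0 x"] assms(5) by (metis mdist_nonneg)
  moreover have "mdist X x x = 0"
    using \<open>x \<in> mspace X\<close> by simp
  ultimately show thesis
    using \<open>x \<in> mspace X\<close> by (intro that[of x y']) linarith+
qed

section \<open>The pullback property\<close>

text \<open>
  Composition and equality of closeness classes reduce to representatives, so the universal
  property becomes two statements about maps: a cone lifts up to closeness, and closeness of
  maps into \<open>P\<close> is detected by the two projections.
\<close>

lemma coarse_pullbackI:
  assumes p: "coarse_map P X p" and q: "coarse_map P Y q"
    and f: "coarse_map X W f" and g: "coarse_map Y W g"
    and comm: "close_maps P W (f \<circ> p) (g \<circ> q)"
    and lift: "\<And>(Z :: 'z metric) u v. coarse_map Z X u \<Longrightarrow> coarse_map Z Y v \<Longrightarrow>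
      close_maps Z W (f \<circ> u) (g \<circ> v) \<Longrightarrow>
      \<exists>h. coarse_map Z P h \<and> close_maps Z X (p \<circ> h) u \<and> close_maps Z Y (q \<circ> h) v"
    and unique: "\<And>(Z :: 'z metric) h k. coarse_map Z P h \<Longrightarrow> coarse_map Z P k \<Longrightarrow>
      close_maps Z X (p \<circ> h) (p \<circ> k) \<Longrightarrow> close_maps Z Y (q \<circ> h) (q \<circ> k) \<Longrightarrow> close_maps Z P h k"
  shows "coarse_pullback TYPE('z) P X Y W
    (coarse_class P X p) (coarse_class P Y q) (coarse_class X W f) (coarse_class Y W g)"
  unfolding coarse_pullback_def
proof (intro conjI allI ballI impI)
  show "coarse_comp P W (coarse_class X W f) (coarse_class P X p) =
      coarse_comp P W (coarse_class Y W g) (coarse_class P Y q)"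
    using p q f g comm by (simp add: coarse_comp_class coarse_class_eq_iff coarse_map_comp)
next
  fix Z :: "'z metric" and U V
  assume U: "U \<in> coarse_hom Z X" and V: "V \<in> coarse_hom Z Y"
    and eq: "coarse_comp Z W (coarse_class X W f) U = coarse_comp Z W (coarse_class Y W g) V"
  obtain u where u: "coarse_map Z X u" "U = coarse_class Z X u"
    using U by (rule coarse_hom_cases)
  obtain v where v: "coarse_map Z Y v" "V = coarse_class Z Y v"
    using V by (rule coarse_hom_cases)
  have "close_maps Z W (f \<circ> u) (g \<circ> v)"
    using eq u v f g
    by (simp add: coarse_comp_class coarse_class_eq_iff coarse_map_comp[of Z X _ W]
        coarse_map_comp[of Z Y _ W])
  then obtain h where h: "coarse_map Z P h" "close_maps Z X (p \<circ> h) u" "close_maps Z Y (q \<circ> h) v"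
    using lift u v by blast
  have ph: "coarse_map Z X (p \<circ> h)" "coarse_map Z Y (q \<circ> h)"
    using h p q by (auto intro: coarse_map_comp)
  have hUV: "coarse_class Z X (p \<circ> h) = U" "coarse_class Z Y (q \<circ> h) = V"
    using h u v ph by (simp_all add: coarse_class_eq_iff)
  show "\<exists>!H. H \<in> coarse_hom Z P \<and> coarse_comp Z X (coarse_class P X p) H = U \<and>
      coarse_comp Z Y (coarse_class P Y q) H = V"
  proof (rule ex1I)
    show "coarse_class Z P h \<in> coarse_hom Z P \<and>
        coarse_comp Z X (coarse_class P X p) (coarse_class Z P h) = U \<and>
        coarse_comp Z Y (coarse_class P Y q) (coarse_class Z P h) = V"
      using h p q hUV by (simp add: coarse_class_in_hom coarse_comp_class)
  next
    fix K
    assume K: "K \<in> coarse_hom Z P \<and> coarse_comp Z X (coarse_class P X p) K = U \<and>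
        coarse_comp Z Y (coarse_class P Y q) K = V"
    then obtain k where k: "coarse_map Z P k" "K = coarse_class Z P k"
      by (auto elim: coarse_hom_cases)
    have pk: "coarse_map Z X (p \<circ> k)" "coarse_map Z Y (q \<circ> k)"
      using k p q by (auto intro: coarse_map_comp)
    have "coarse_class Z X (p \<circ> k) = coarse_class Z X (p \<circ> h)"
      "coarse_class Z Y (q \<circ> k) = coarse_class Z Y (q \<circ> h)"
      using K k p q hUV by (simp_all add: coarse_comp_class)
    then have "close_maps Z P k h"
      using unique h k ph pk by (simp add: coarse_class_eq_iff)
    then show "K = coarse_class Z P h"
      using h k by (simp add: coarse_class_eq_iff)
  qed
qed (use p q f g in \<open>auto intro: coarse_class_in_hom\<close>)

lemma asymptotic_product_lift:
  assumes x0: "x0 \<in> mspace X" and y0: "y0 \<in> mspace Y"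
    and geom: "geodesic_space X \<and> geodesic_space Y \<or> visual_from Y y0" and R: "0 \<le> R"
    and u: "coarse_map Z X u" and v: "coarse_map Z Y v"
    and C: "\<And>z. z \<in> mspace Z \<Longrightarrow> \<bar>mdist X x0 (u z) - mdist Y y0 (v z)\<bar> \<le> C"
  obtains h where "coarse_map Z (asymptotic_product X x0 Y y0 R) h"
    "close_maps Z X (fst \<circ> h) u" "close_maps Z Y (snd \<circ> h) v"
proof -
  have "\<exists>w. w \<in> mspace (asymptotic_product X x0 Y y0 R) \<and>
      mdist X (u z) (fst w) \<le> C \<and> mdist Y (v z) (snd w) \<le> C" if z: "z \<in> mspace Z" for z
  proof -
    have uv: "u z \<in> mspace X" "v z \<in> mspace Y"
      using z u v by (auto intro: coarse_map_in)
    obtain x' y' where "x' \<in> mspace X" "y' \<in> mspace Y" "mdist X x0 x' = mdist Y y0 y'"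
      "mdist X (u z) x' \<le> \<bar>mdist X x0 (u z) - mdist Y y0 (v z)\<bar>"
      "mdist Y (v z) y' \<le> \<bar>mdist X x0 (u z) - mdist Y y0 (v z)\<bar>"
      by (rule equal_radius_points[OF x0 y0 geom uv])
    then show ?thesis
      using R C[OF z] by (intro exI[of _ "(x', y')"]) (auto simp: mspace_asymptotic_product)
  qed
  then obtain h where h: "\<And>z. z \<in> mspace Z \<Longrightarrow> h z \<in> mspace (asymptotic_product X x0 Y y0 R)"
    and hu: "\<And>z. z \<in> mspace Z \<Longrightarrow> mdist X (u z) (fst (h z)) \<le> C"
    and hv: "\<And>z. z \<in> mspace Z \<Longrightarrow> mdist Y (v z) (snd (h z)) \<le> C"
    by metis
  have hu': "close_maps Z X u (fst \<circ> h)" and hv': "close_maps Z Y v (snd \<circ> h)"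
    using hu hv by (auto simp: close_maps_iff)
  have into: "fst \<circ> h \<in> mspace Z \<rightarrow> mspace X" "snd \<circ> h \<in> mspace Z \<rightarrow> mspace Y"
    using h by (force simp: mspace_asymptotic_product)+
  have "coarse_map Z (asymptotic_product X x0 Y y0 R) h"
    using h coarse_map_close[OF u into(1) hu'] coarse_map_close[OF v into(2) hv']
    by (auto intro: coarse_map_into_asymptotic_product)
  moreover have "close_maps Z X (fst \<circ> h) u" "close_maps Z Y (snd \<circ> h) v"
    using hu' hv' by (simp_all add: close_maps_iff mdist_commute)
  ultimately show thesis by (rule that)
qed

theorem theorem14:
  fixes X :: "'a metric" and Y :: "'b metric"
    and x0 :: 'a and y0 :: 'b and R :: real
  assumes "x0 \<in> mspace X" and "y0 \<in> mspace Y"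
    and "geodesic_space X \<and> geodesic_space Y \<or> visual_from Y y0"
    and "0 \<le> R"
  shows "coarse_pullback TYPE('z)
           (asymptotic_product X x0 Y y0 R) X Y (interval_metric {0..})
           (coarse_class (asymptotic_product X x0 Y y0 R) X fst)
           (coarse_class (asymptotic_product X x0 Y y0 R) Y snd)
           (coarse_class X (interval_metric {0..}) (\<lambda>x. mdist X x x0))
           (coarse_class Y (interval_metric {0..}) (\<lambda>y. mdist Y y y0))"
proof (rule coarse_pullbackI)
  show "close_maps (asymptotic_product X x0 Y y0 R) (interval_metric {0..})
      ((\<lambda>x. mdist X x x0) \<circ> fst) ((\<lambda>y. mdist Y y y0) \<circ> snd)"
    by (auto simp: close_maps_iff mspace_asymptotic_product dist_real_def mdist_commute
        intro!: exI[of _ R])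
next
  fix Z :: "'z metric" and u v
  assume u: "coarse_map Z X u" and v: "coarse_map Z Y v"
    and "close_maps Z (interval_metric {0..}) ((\<lambda>x. mdist X x x0) \<circ> u) ((\<lambda>y. mdist Y y y0) \<circ> v)"
  then obtain C where "\<And>z. z \<in> mspace Z \<Longrightarrow> \<bar>mdist X x0 (u z) - mdist Y y0 (v z)\<bar> \<le> C"
    by (auto simp: close_maps_iff dist_real_def mdist_commute)
  then show "\<exists>h. coarse_map Z (asymptotic_product X x0 Y y0 R) h \<and>
      close_maps Z X (fst \<circ> h) u \<and> close_maps Z Y (snd \<circ> h) v"
    using asymptotic_product_lift[OF assms u v] by metis
qed (use assms in \<open>auto intro: coarse_map_asymptotic_fst coarse_map_asymptotic_snd
    coarse_map_radius close_maps_into_asymptotic_product\<close>)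

end
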